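(* Let $Z$ be a Banach space over $\mathbb{K}$, let $u\in S_Z$, and let $C\subseteq B_{Z^*}$ be such that $B_{Z^*}=\overline{\operatorname{conv}}^{w^*}(C)$. Then, for every $z\in Z$, $$V(Z,u,z)=\operatorname{conv}\Bigl(\bigcap_{\delta>0}\overline{\{\phi(z)\colon \phi\in C,\ \operatorname{Re}\phi(u)>1-\delta\}}\Bigr)=\operatorname{conv}\bigl(\{\lim \phi_n(z)\colon \phi_n\in C\ \forall n\in\mathbb{N},\ \lim\phi_n(u)=1\}\bigr).$$
   Context: $\mathbb{K}$ is $\mathbb{R}$ or $\mathbb{C}$. $B_Z$ and $S_Z$ are the closed unit ball and unit sphere of $Z$, $Z^*$ is the topological dual. For $u\in S_Z$ and $z\in Z$, the abstract numerical range is $V(Z,u,z):=\{\phi(z)\colon \phi\in S_{Z^*},\ \phi(u)=1\}\subset\mathbb{K}$. $\operatorname{conv}$ is the convex hull, $\overline{\operatorname{conv}}^{w^*}$ the weak-star closed convex hull. Writing $\lim a_n$ for a bounded scalar sequence means that the sequence is required to be convergent (so the last set consists of the limits $\lim\phi_n(z)$ over all sequences $(\phi_n)$ in $C$ for which $\phi_n(u)\to1$ and $\phi_n(z)$ converges). *)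

theory Defs
  imports "HOL-Analysis.Analysis"
begin

text \<open>
  The scalar field is a type \<open>'k\<close> that is, up to an isometric isomorphism of real algebras,
  either the field of real numbers or the field of complex numbers.
\<close>

class real_or_complex = real_normed_field +
  fixes to_complex :: "'a \<Rightarrow> complex"
  assumes to_complex_add: "to_complex (x + y) = to_complex x + to_complex y"
    and to_complex_mult: "to_complex (x * y) = to_complex x * to_complex y"
    and to_complex_one: "to_complex 1 = 1"
    and to_complex_scaleR: "to_complex (r *\<^sub>R x) = r *\<^sub>R to_complex x"
    and norm_to_complex: "norm (to_complex x) = norm x"
    and range_to_complex: "range to_complex = \<real> \<or> range to_complex = UNIV"

instantiation real :: real_or_complex
begin

definition to_complex_real :: "real \<Rightarrow> complex"
  where "to_complex_real = complex_of_real"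

instance
  by standard (auto simp: to_complex_real_def Reals_def scaleR_conv_of_real)

end

instantiation complex :: real_or_complex
begin

definition to_complex_complex :: "complex \<Rightarrow> complex"
  where "to_complex_complex x = x"

instance
  by standard (auto simp: to_complex_complex_def)

end

definition re_part :: "'k::real_or_complex \<Rightarrow> real"
  where "re_part x = Re (to_complex x)"

text \<open>
  A normed space over \<open>'k\<close>. The last axiom says that the real vector space structure carried by
  the type class of \<open>'z\<close> is the restriction of the given one to real scalars. If \<open>'z\<close> has
  sort \<open>banach\<close>, this is a Banach space over \<open>'k\<close>.
\<close>

locale normed_space_over = vector_space smul
  for smul :: "'k::real_or_complex \<Rightarrow> 'z::real_normed_vector \<Rightarrow> 'z" +
  assumes norm_smul: "norm (smul c x) = norm c * norm x"
    and smul_of_real: "smul (of_real r) x = r *\<^sub>R x"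

lemma normed_space_over_real: "normed_space_over (scaleR :: real \<Rightarrow> 'z::real_normed_vector \<Rightarrow> 'z)"
  by standard (auto simp: algebra_simps)

lemma normed_space_over_self: "normed_space_over ((*) :: 'k::real_or_complex \<Rightarrow> 'k \<Rightarrow> 'k)"
  by standard (auto simp: algebra_simps norm_mult scaleR_conv_of_real)

text \<open>
  The elements of \<open>'z \<Rightarrow>\<^sub>L 'k\<close> are in general only real-linear, so the topological dual consists of those that are
  linear over \<open>'k\<close>. Its norm is the operator norm of \<open>'z \<Rightarrow>\<^sub>L 'k\<close>.
\<close>

definition dual_space :: "('k::real_or_complex \<Rightarrow> 'z::real_normed_vector \<Rightarrow> 'z) \<Rightarrow> ('z \<Rightarrow>\<^sub>L 'k) set"
  where "dual_space smul = {\<phi>. Vector_Spaces.linear smul (*) (blinfun_apply \<phi>)}"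

definition dual_ball :: "('k::real_or_complex \<Rightarrow> 'z::real_normed_vector \<Rightarrow> 'z) \<Rightarrow> ('z \<Rightarrow>\<^sub>L 'k) set"
  where "dual_ball smul = {\<phi> \<in> dual_space smul. norm \<phi> \<le> 1}"

definition dual_sphere :: "('k::real_or_complex \<Rightarrow> 'z::real_normed_vector \<Rightarrow> 'z) \<Rightarrow> ('z \<Rightarrow>\<^sub>L 'k) set"
  where "dual_sphere smul = {\<phi> \<in> dual_space smul. norm \<phi> = 1}"

text \<open>
  The strong operator topology on \<open>'z \<Rightarrow>\<^sub>L 'k\<close> is the topology of pointwise convergence; on scalar-valued
  maps this is the weak-star topology.
\<close>

definition weak_star_topology ::
    "('k::real_or_complex \<Rightarrow> 'z::real_normed_vector \<Rightarrow> 'z) \<Rightarrow> ('z \<Rightarrow>\<^sub>L 'k) topology"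
  where "weak_star_topology smul = subtopology strong_operator_topology (dual_space smul)"

definition numerical_range ::
    "('k::real_or_complex \<Rightarrow> 'z::real_normed_vector \<Rightarrow> 'z) \<Rightarrow> 'z \<Rightarrow> 'z \<Rightarrow> 'k set"
  where "numerical_range smul u z =
    {blinfun_apply \<phi> z | \<phi>. \<phi> \<in> dual_sphere smul \<and> blinfun_apply \<phi> u = 1}"

end

theory Submission
  imports Defs
begin

text \<open>
  The map \<open>\<phi> \<mapsto> (\<phi> u, \<phi> z)\<close> sends the dual ball, which is weak-star compact, onto a compact convex
  subset of a finite-dimensional real space, namely the convex hull of the closure of the image of \<open>C\<close>.
  The numerical range is the slice of this set where the first coordinate is 1. Since the first
  coordinate has real part at most 1, this slice is a face, hence the convex hull of the points of
  the closure of the image of \<open>C\<close> lying in it; these are the pairs \<open>(1, l)\<close> with \<open>l\<close> a limit as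
  in the theorem.
\<close>

section \<open>Scalars embedded in the complex plane\<close>

lemma bounded_linear_to_complex: "bounded_linear (to_complex :: 'k::real_or_complex \<Rightarrow> complex)"
  by (rule bounded_linear_intro[where K = 1])
    (simp_all add: to_complex_add to_complex_scaleR norm_to_complex)

text \<open>Closedness guarantees that a complex limit of embedded scalars is again an embedded
  scalar, so limits found in the plane can be pulled back to \<open>'k\<close>.\<close>

lemma closed_range_to_complex: "closed (range (to_complex :: 'k::real_or_complex \<Rightarrow> complex))"
  using range_to_complex[where 'a = 'k] closed_complex_Reals by auto

lemma dist_to_complex: "dist (to_complex x) (to_complex y) = dist x (y :: 'k::real_or_complex)"
  by (simp add: dist_norm norm_to_complex
      flip: linear_diff[OF bounded_linear.linear[OF bounded_linear_to_complex]])

lemma tendsto_to_complex_iff: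
  fixes f :: "'a \<Rightarrow> 'k::real_or_complex"
  shows "((\<lambda>n. to_complex (f n)) \<longlongrightarrow> to_complex l) F \<longleftrightarrow> (f \<longlongrightarrow> l) F"
  by (simp add: tendsto_iff dist_to_complex)

text \<open>For |w| \<le> 1 one has |w - 1|^2 = |w|^2 + 1 - 2 Re w \<le> 2 (1 - Re w), so the real
  part alone controls the distance to 1. This reconciles the slices, which constrain only a real
  part, with sequences along which the full value at \<open>u\<close> tends to 1.\<close>

lemma tendsto_1_iff_re_part:
  fixes f :: "'a \<Rightarrow> 'k::real_or_complex"
  assumes le: "\<And>n. norm (f n) \<le> 1"
  shows "(f \<longlongrightarrow> 1) F \<longleftrightarrow> ((\<lambda>n. re_part (f n)) \<longlongrightarrow> 1) F"
proof
  assume "(f \<longlongrightarrow> 1) F"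
  then have "((\<lambda>n. to_complex (f n)) \<longlongrightarrow> 1) F"
    using tendsto_to_complex_iff[of f 1 F] by (simp add: to_complex_one)
  then show "((\<lambda>n. re_part (f n)) \<longlongrightarrow> 1) F"
    unfolding re_part_def using tendsto_Re by force
next
  assume re: "((\<lambda>n. re_part (f n)) \<longlongrightarrow> 1) F"
  have *: "(norm (f n - 1))\<^sup>2 \<le> 2 * (1 - re_part (f n))" for n
  proof -
    have "(cmod (to_complex (f n) - 1))\<^sup>2 = (cmod (to_complex (f n)))\<^sup>2 + 1 - 2 * Re (to_complex (f n))"
      by (simp only: cmod_power2) (simp add: power2_eq_square algebra_simps)
    moreover have "(cmod (to_complex (f n)))\<^sup>2 \<le> 1"
      by (simp add: norm_to_complex le power_le_one)
    ultimately have "(cmod (to_complex (f n) - 1))\<^sup>2 \<le> 2 * (1 - Re (to_complex (f n)))"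
      by simp
    then show ?thesis
      using dist_to_complex[of "f n" 1] by (simp add: dist_norm to_complex_one re_part_def)
  qed
  have "((\<lambda>n. 2 * (1 - re_part (f n))) \<longlongrightarrow> 2 * (1 - 1)) F"
    by (intro tendsto_intros re)
  then have lim: "((\<lambda>n. 2 * (1 - re_part (f n))) \<longlongrightarrow> 0) F"
    by simp
  have "((\<lambda>n. (norm (f n - 1))\<^sup>2) \<longlongrightarrow> 0) F"
    by (rule real_tendsto_sandwich[OF _ _ tendsto_const lim])
      (intro always_eventually allI zero_le_power2 *)+
  then have "((\<lambda>n. sqrt ((norm (f n - 1))\<^sup>2)) \<longlongrightarrow> sqrt 0) F"
    by (rule tendsto_real_sqrt)
  then have "((\<lambda>n. norm (f n - 1)) \<longlongrightarrow> 0) F"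
    by simp
  then show "(f \<longlongrightarrow> 1) F"
    by (rule Lim_null[THEN iffD2, OF tendsto_norm_zero_cancel])
qed

text \<open>Sequential compactness of the complex disc is pulled back along the isometry
  \<open>to_complex\<close>, whose range is closed.\<close>

lemma compact_cball_real_or_complex: "compact (cball (0 :: 'k::real_or_complex) r)"
  unfolding compact_def
proof (intro allI impI)
  fix f :: "nat \<Rightarrow> 'k"
  assume f: "\<forall>n. f n \<in> cball 0 r"
  have "compact (cball (0::complex) r \<inter> range (to_complex :: 'k \<Rightarrow> complex))"
    by (intro compact_Int_closed compact_cball closed_range_to_complex)
  moreover have "\<forall>n. to_complex (f n) \<in> cball 0 r \<inter> range (to_complex :: 'k \<Rightarrow> complex)"
    using f by (auto simp: norm_to_complex)
  ultimately obtain c s where "c \<in> cball 0 r \<inter> range (to_complex :: 'k \<Rightarrow> complex)" "strict_mono s"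
    and "((\<lambda>n. to_complex (f n)) \<circ> s) \<longlonglongrightarrow> c"
    unfolding compact_def by metis
  then obtain l :: 'k where "l \<in> cball 0 r" "(\<lambda>n. to_complex ((f \<circ> s) n)) \<longlonglongrightarrow> to_complex l"
    by (auto simp: norm_to_complex o_def)
  with \<open>strict_mono s\<close> show "\<exists>l\<in>cball 0 r. \<exists>s. strict_mono s \<and> (f \<circ> s) \<longlonglongrightarrow> l"
    by (auto simp only: tendsto_to_complex_iff)
qed

section \<open>Weak-star compactness of the dual ball\<close>

lemma linear_smul_iff:
  fixes smul :: "'k::real_or_complex \<Rightarrow> 'z::real_normed_vector \<Rightarrow> 'z" and f :: "'z \<Rightarrow> 'k"
  assumes "normed_space_over smul"
  shows "Vector_Spaces.linear smul (*) f \<longleftrightarrow>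
    (\<forall>x y. f (x + y) = f x + f y) \<and> (\<forall>c x. f (smul c x) = c * f x)"
  using normed_space_over.axioms(1)[OF assms] normed_space_over.axioms(1)[OF normed_space_over_self[where 'k = 'k]]
  by (simp add: Vector_Spaces.linear_iff)

text \<open>The pointwise bounds cut out a product of compact discs, compact by Tychonoff, and
  linearity is a closed condition because it consists of equations between coordinates. Bare
  functions are used since their topology is the product topology, unlike the norm topology of
  \<open>'z \<Rightarrow>\<^sub>L 'k\<close>.\<close>

lemma banach_alaoglu:
  fixes smul :: "'k::real_or_complex \<Rightarrow> 'z::real_normed_vector \<Rightarrow> 'z"
  assumes "normed_space_over smul"
  shows "compact {f. Vector_Spaces.linear smul (*) f \<and> (\<forall>x. norm (f x) \<le> norm x)}"
proof -
  have "compactin (product_topology (\<lambda>_. euclidean) UNIV) (PiE UNIV (\<lambda>x::'z. cball (0::'k) (norm x)))"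
    by (simp add: compactin_PiE compact_cball_real_or_complex)
  then have "compact (PiE UNIV (\<lambda>x::'z. cball (0::'k) (norm x)))"
    by (simp add: euclidean_product_topology)
  moreover have "closed {f :: 'z \<Rightarrow> 'k. Vector_Spaces.linear smul (*) f}"
    unfolding linear_smul_iff[OF assms]
    by (intro closed_Collect_conj closed_Collect_all closed_Collect_eq continuous_intros
        continuous_on_product_coordinates)
  moreover have "{f. Vector_Spaces.linear smul (*) f \<and> (\<forall>x. norm (f x) \<le> norm x)} =
      PiE UNIV (\<lambda>x::'z. cball (0::'k) (norm x)) \<inter> {f. Vector_Spaces.linear smul (*) f}"
    by (auto simp: PiE_iff)
  ultimately show ?thesis
    by (simp add: compact_Int_closed)
qed

lemma dual_ball_eq:
  fixes smul :: "'k::real_or_complex \<Rightarrow> 'z::real_normed_vector \<Rightarrow> 'z"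
  assumes "normed_space_over smul"
  shows "blinfun_apply ` dual_ball smul = {f. Vector_Spaces.linear smul (*) f \<and> (\<forall>x. norm (f x) \<le> norm x)}"
proof (intro equalityI subsetI)
  fix f assume "f \<in> blinfun_apply ` dual_ball smul"
  then obtain \<phi> where \<phi>: "\<phi> \<in> dual_ball smul" "f = blinfun_apply \<phi>" by blast
  have "norm (f x) \<le> norm x" for x
    using norm_blinfun[of \<phi> x] \<phi> mult_right_mono[of "norm \<phi>" 1 "norm x"]
    by (auto simp: dual_ball_def)
  then show "f \<in> {f. Vector_Spaces.linear smul (*) f \<and> (\<forall>x. norm (f x) \<le> norm x)}"
    using \<phi> by (auto simp: dual_ball_def dual_space_def)
next
  fix f assume f: "f \<in> {f. Vector_Spaces.linear smul (*) f \<and> (\<forall>x. norm (f x) \<le> norm x)}"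
  interpret normed_space_over smul by fact
  \<comment> \<open>Real homogeneity is the case of a real scalar in \<open>'k\<close>-homogeneity;
    it is needed to view \<open>f\<close> as a bounded real-linear map.\<close>
  have "f (r *\<^sub>R x) = r *\<^sub>R f x" for r x
    using f linear_smul_iff[OF assms, of f]
    by (simp add: scaleR_conv_of_real flip: smul_of_real)
  then have "bounded_linear f"
    using f linear_smul_iff[OF assms, of f]
    by (intro bounded_linear_intro[where K = 1]) auto
  then have app: "blinfun_apply (Blinfun f) = f"
    by (rule bounded_linear_Blinfun_apply)
  moreover have "norm (Blinfun f) \<le> 1"
    using f by (intro norm_blinfun_bound) (auto simp: app)
  ultimately show "f \<in> blinfun_apply ` dual_ball smul"
    using f by (intro image_eqI[of _ _ "Blinfun f"]) (auto simp: dual_ball_def dual_space_def)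
qed

lemma norm_apply_dual_ball_le:
  fixes smul :: "'k::real_or_complex \<Rightarrow> 'z::real_normed_vector \<Rightarrow> 'z"
  assumes "normed_space_over smul" "\<phi> \<in> dual_ball smul"
  shows "norm (blinfun_apply \<phi> x) \<le> norm x"
  using dual_ball_eq[OF assms(1)] assms(2) by blast

text \<open>Evaluation at two points is continuous for pointwise convergence, so this is a
  continuous image of a compact set. Closedness lets a limit of pairs of values be attained by one
  functional, without extracting a weak-star convergent subsequence of functionals.\<close>

lemma closed_dual_ball_values:
  fixes smul :: "'k::real_or_complex \<Rightarrow> 'z::real_normed_vector \<Rightarrow> 'z"
  assumes "normed_space_over smul"
  shows "closed ((\<lambda>\<phi>. (blinfun_apply \<phi> u, blinfun_apply \<phi> z)) ` dual_ball smul)"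
proof -
  have "continuous_on UNIV (\<lambda>f :: 'z \<Rightarrow> 'k. (f u, f z))"
    by (intro continuous_intros continuous_on_product_coordinates)
  then have "compact ((\<lambda>f. (f u, f z)) ` (blinfun_apply ` dual_ball smul))"
    unfolding dual_ball_eq[OF assms]
    by (intro compact_continuous_image banach_alaoglu assms) (rule continuous_on_subset, auto)
  then show ?thesis
    by (simp add: image_image compact_imp_closed)
qed

section \<open>The numerical range as a convex set\<close>

text \<open>A functional with value 1 at the unit vector \<open>u\<close> has norm at least 1, so
  the sphere may be replaced by the ball, which is convex.\<close>

lemma numerical_range_eq_dual_ball:
  fixes smul :: "'k::real_or_complex \<Rightarrow> 'z::real_normed_vector \<Rightarrow> 'z"
  assumes "norm u = 1"
  shows "numerical_range smul u z =
    {blinfun_apply \<phi> z | \<phi>. \<phi> \<in> dual_ball smul \<and> blinfun_apply \<phi> u = 1}"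
proof -
  have "norm \<phi> = 1" if "norm \<phi> \<le> 1" "blinfun_apply \<phi> u = 1" for \<phi> :: "'z \<Rightarrow>\<^sub>L 'k"
    using that norm_blinfun[of \<phi> u] assms by simp
  then show ?thesis
    unfolding numerical_range_def dual_ball_def dual_sphere_def by force
qed

text \<open>By the ball description this is the image, under the real-linear evaluation at
  \<open>z\<close>, of the dual ball cut by an affine subspace.\<close>

lemma convex_numerical_range:
  fixes smul :: "'k::real_or_complex \<Rightarrow> 'z::real_normed_vector \<Rightarrow> 'z"
  assumes "normed_space_over smul" "norm u = 1"
  shows "convex (numerical_range smul u z)"
proof -
  have "convex (dual_ball smul)"
  proof (rule convexI)
    fix \<phi> \<psi> and a b :: real
    assume *: "\<phi> \<in> dual_ball smul" "\<psi> \<in> dual_ball smul" "0 \<le> a" "0 \<le> b" "a + b = 1"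
    then have "norm (a *\<^sub>R \<phi> + b *\<^sub>R \<psi>) \<le> 1"
      using convexD[OF convex_cball, of \<phi> 0 1 \<psi> a b] by (simp add: dual_ball_def)
    with * show "a *\<^sub>R \<phi> + b *\<^sub>R \<psi> \<in> dual_ball smul"
      by (auto simp: dual_ball_def dual_space_def linear_smul_iff[OF assms(1)]
          blinfun.add_left blinfun.scaleR_left algebra_simps)
  qed
  moreover have "convex {\<phi>. blinfun_apply \<phi> u = (1::'k)}"
    by (rule convexI) (simp add: blinfun.add_left blinfun.scaleR_left flip: scaleR_add_left)
  ultimately have "convex ((\<lambda>\<phi>. blinfun_apply \<phi> z) ` (dual_ball smul \<inter> {\<phi>. blinfun_apply \<phi> u = 1}))"
    by (intro convex_linear_image convex_Int)
      (auto intro!: linearI simp: blinfun.add_left blinfun.scaleR_left)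
  then show ?thesis
    unfolding numerical_range_eq_dual_ball[OF assms(2)]
    by (rule back_subst[of convex]) auto
qed

section \<open>Limits of values along sequences in \<open>C\<close>\<close>

definition limit_values :: "('z::real_normed_vector \<Rightarrow>\<^sub>L 'k::real_or_complex) set \<Rightarrow> 'z \<Rightarrow> 'z \<Rightarrow> 'k set"
  where "limit_values C u z = {l. \<exists>\<phi> :: nat \<Rightarrow> 'z \<Rightarrow>\<^sub>L 'k. (\<forall>n. \<phi> n \<in> C)
            \<and> (\<lambda>n. blinfun_apply (\<phi> n) u) \<longlonglongrightarrow> 1
            \<and> (\<lambda>n. blinfun_apply (\<phi> n) z) \<longlonglongrightarrow> l}"

lemma Inter_closure_slices_eq_limit_values:
  fixes C :: "('z::real_normed_vector \<Rightarrow>\<^sub>L 'k::real_or_complex) set"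
  assumes le: "\<And>\<phi>. \<phi> \<in> C \<Longrightarrow> norm (blinfun_apply \<phi> u) \<le> 1"
  shows "(\<Inter>\<delta>\<in>{0::real<..}. closure {blinfun_apply \<phi> z | \<phi>. \<phi> \<in> C \<and> re_part (blinfun_apply \<phi> u) > 1 - \<delta>})
    = limit_values C u z"
proof (intro equalityI subsetI)
  fix l
  assume l: "l \<in> (\<Inter>\<delta>\<in>{0::real<..}. closure {blinfun_apply \<phi> z | \<phi>. \<phi> \<in> C \<and> re_part (blinfun_apply \<phi> u) > 1 - \<delta>})"
  \<comment> \<open>The choice \<delta> = 1 / (n + 1) also serves as the tolerance at
    \<open>z\<close>, so one functional per index yields both limits.\<close>
  have "\<exists>\<phi>\<in>C. re_part (blinfun_apply \<phi> u) > 1 - 1 / Suc n \<and> dist (blinfun_apply \<phi> z) l < 1 / Suc n" for n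
  proof -
    have "l \<in> closure {blinfun_apply \<phi> z | \<phi>. \<phi> \<in> C \<and> re_part (blinfun_apply \<phi> u) > 1 - 1 / Suc n}"
      by (rule INT_D[OF l]) simp
    then have "\<exists>y\<in>{blinfun_apply \<phi> z | \<phi>. \<phi> \<in> C \<and> re_part (blinfun_apply \<phi> u) > 1 - 1 / Suc n}.
        dist y l < 1 / Suc n"
      unfolding closure_approachable by (rule allE[of _ "1 / Suc n"]) simp
    then show ?thesis by blast
  qed
  then obtain \<phi> where \<phi>: "\<And>n. \<phi> n \<in> C" "\<And>n. re_part (blinfun_apply (\<phi> n) u) > 1 - 1 / Suc n"
      "\<And>n. dist (blinfun_apply (\<phi> n) z) l < 1 / Suc n"
    by metis
  have re_le: "re_part (blinfun_apply (\<phi> n) u) \<le> 1" for n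
    using complex_Re_le_cmod[of "to_complex (blinfun_apply (\<phi> n) u)"] le[OF \<phi>(1), of n]
    by (simp add: re_part_def norm_to_complex)
  have lim: "(\<lambda>n. 1 / real (Suc n)) \<longlonglongrightarrow> 0"
    using LIMSEQ_inverse_real_of_nat by (simp add: inverse_eq_divide)
  have "(\<lambda>n. re_part (blinfun_apply (\<phi> n) u)) \<longlonglongrightarrow> 1"
  proof (rule real_tendsto_sandwich[OF _ _ _ tendsto_const])
    show "\<forall>\<^sub>F n in sequentially. 1 - 1 / real (Suc n) \<le> re_part (blinfun_apply (\<phi> n) u)"
      by (intro always_eventually allI less_imp_le \<phi>(2))
    show "\<forall>\<^sub>F n in sequentially. re_part (blinfun_apply (\<phi> n) u) \<le> 1"
      by (intro always_eventually allI re_le)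
    show "(\<lambda>n. 1 - 1 / real (Suc n)) \<longlonglongrightarrow> 1"
      using tendsto_diff[OF tendsto_const lim, of 1] by (simp only: diff_0_right)
  qed
  then have "(\<lambda>n. blinfun_apply (\<phi> n) u) \<longlonglongrightarrow> 1"
    by (simp add: tendsto_1_iff_re_part le \<phi>(1))
  moreover have "(\<lambda>n. dist (blinfun_apply (\<phi> n) z) l) \<longlonglongrightarrow> 0"
    by (rule real_tendsto_sandwich[OF _ _ tendsto_const lim])
      (intro always_eventually allI zero_le_dist less_imp_le[OF \<phi>(3)])+
  then have "(\<lambda>n. blinfun_apply (\<phi> n) z) \<longlonglongrightarrow> l"
    by (rule tendsto_dist_iff[THEN iffD2])
  ultimately show "l \<in> limit_values C u z"
    using \<phi>(1) unfolding limit_values_def by blast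
next
  fix l assume "l \<in> limit_values C u z"
  then obtain \<phi> where \<phi>: "\<And>n. \<phi> n \<in> C" "(\<lambda>n. blinfun_apply (\<phi> n) u) \<longlonglongrightarrow> 1"
      "(\<lambda>n. blinfun_apply (\<phi> n) z) \<longlonglongrightarrow> l"
    unfolding limit_values_def by blast
  have re: "(\<lambda>n. re_part (blinfun_apply (\<phi> n) u)) \<longlonglongrightarrow> 1"
    using \<phi>(2) tendsto_1_iff_re_part[of "\<lambda>n. blinfun_apply (\<phi> n) u"] le \<phi>(1) by blast
  show "l \<in> (\<Inter>\<delta>\<in>{0::real<..}. closure {blinfun_apply \<phi> z | \<phi>. \<phi> \<in> C \<and> re_part (blinfun_apply \<phi> u) > 1 - \<delta>})"
  proof
    fix \<delta> :: real assume "\<delta> \<in> {0<..}"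
    then have "\<forall>\<^sub>F n in sequentially. re_part (blinfun_apply (\<phi> n) u) > 1 - \<delta>"
      by (intro order_tendstoD(1)[OF re]) simp
    then have "\<forall>\<^sub>F n in sequentially.
        blinfun_apply (\<phi> n) z \<in> closure {blinfun_apply \<phi> z | \<phi>. \<phi> \<in> C \<and> re_part (blinfun_apply \<phi> u) > 1 - \<delta>}"
      by eventually_elim (auto intro!: subsetD[OF closure_subset] \<phi>(1))
    then show "l \<in> closure {blinfun_apply \<phi> z | \<phi>. \<phi> \<in> C \<and> re_part (blinfun_apply \<phi> u) > 1 - \<delta>}"
      by (intro Lim_in_closed_set[OF closed_closure _ _ \<phi>(3)]) auto
  qed
qed

text \<open>The pair (1, l) is a limit of pairs of values on the dual ball, and these form a closed
  set; a functional attaining the pair witnesses membership.\<close>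

lemma limit_values_subset_numerical_range:
  fixes smul :: "'k::real_or_complex \<Rightarrow> 'z::real_normed_vector \<Rightarrow> 'z"
  assumes "normed_space_over smul" "norm u = 1" "C \<subseteq> dual_ball smul"
  shows "limit_values C u z \<subseteq> numerical_range smul u z"
proof
  fix l assume "l \<in> limit_values C u z"
  then obtain \<phi> where \<phi>: "\<And>n. \<phi> n \<in> C" "(\<lambda>n. blinfun_apply (\<phi> n) u) \<longlonglongrightarrow> 1"
      "(\<lambda>n. blinfun_apply (\<phi> n) z) \<longlonglongrightarrow> l"
    unfolding limit_values_def by blast
  have "(1, l) \<in> (\<lambda>\<phi>. (blinfun_apply \<phi> u, blinfun_apply \<phi> z)) ` dual_ball smul"
    using \<phi>(1) assms(3)
    by (intro closed_sequentially[OF closed_dual_ball_values[OF assms(1)] _ tendsto_Pair[OF \<phi>(2,3)]]) auto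
  then show "l \<in> numerical_range smul u z"
    unfolding numerical_range_eq_dual_ball[OF assms(2)] by force
qed

section \<open>The finite-dimensional image of the dual ball\<close>

text \<open>Values are embedded in \<open>complex \<times> complex\<close>, a Euclidean space
  whichever field \<open>'k\<close> is, so that compactness of convex hulls and the theory of faces
  apply.\<close>

definition complex_values :: "'z::real_normed_vector \<Rightarrow> 'z \<Rightarrow> ('z \<Rightarrow>\<^sub>L 'k::real_or_complex) \<Rightarrow> complex \<times> complex"
  where "complex_values u z \<phi> = (to_complex (blinfun_apply \<phi> u), to_complex (blinfun_apply \<phi> z))"

lemma linear_complex_values: "linear (complex_values u z)"
  by (rule linearI)
    (auto simp: complex_values_def blinfun.add_left blinfun.scaleR_left to_complex_add to_complex_scaleR)

lemma continuous_map_complex_values: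
  fixes smul :: "'k::real_or_complex \<Rightarrow> 'z::real_normed_vector \<Rightarrow> 'z"
  shows "continuous_map (weak_star_topology smul) euclidean (complex_values u z)"
proof -
  have "continuous_map strong_operator_topology euclidean (\<lambda>\<phi>. to_complex (blinfun_apply \<phi> x :: 'k))"
    for x :: 'z
    using continuous_map_compose[OF strong_operator_topology_continuous_evaluation,
        of euclidean to_complex x]
    by (simp add: o_def linear_continuous_on[OF bounded_linear_to_complex])
  then show ?thesis
    unfolding weak_star_topology_def prod_topology_euclidean[symmetric] complex_values_def[abs_def]
    by (intro continuous_map_from_subtopology continuous_map_pairedI)
qed

lemma bounded_complex_values:
  assumes "normed_space_over smul" "C \<subseteq> dual_ball smul"
  shows "bounded (complex_values u z ` C)"
proof -
  have "norm (complex_values u z \<psi>) \<le> norm u + norm z" if "\<psi> \<in> C" for \<psi>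
  proof -
    have "norm (complex_values u z \<psi>) \<le> norm (blinfun_apply \<psi> u) + norm (blinfun_apply \<psi> z)"
      unfolding complex_values_def by (rule order.trans[OF norm_Pair_le]) (simp add: norm_to_complex)
    also have "\<dots> \<le> norm u + norm z"
      using that assms(2) by (intro add_mono norm_apply_dual_ball_le[OF assms(1)]) auto
    finally show ?thesis .
  qed
  then show ?thesis
    unfolding bounded_iff by auto
qed

text \<open>In finite dimension the convex hull of a compact set is compact, so the right-hand side
  is already closed.\<close>

lemma closure_convex_hull_subset:
  fixes S :: "'a::euclidean_space set"
  assumes "bounded S"
  shows "closure (convex hull S) \<subseteq> convex hull (closure S)"
proof (rule closure_minimal)
  show "closed (convex hull (closure S))"
    using assms by (intro compact_imp_closed compact_convex_hull) simp
qed (intro hull_mono closure_subset)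

text \<open>Weak-star continuity sends the closure of the hull of \<open>C\<close> into the closure
  of the image, and linearity moves the hull outside the image. Exchanging closure and hull then
  leaves points that are limits of values of single elements of \<open>C\<close>.\<close>

lemma complex_values_weak_star_closure:
  assumes "normed_space_over smul" "C \<subseteq> dual_ball smul"
    and "\<phi> \<in> weak_star_topology smul closure_of (convex hull C)"
  shows "complex_values u z \<phi> \<in> convex hull (closure (complex_values u z ` C))"
proof -
  have "complex_values u z \<phi> \<in> closure (complex_values u z ` (convex hull C))"
    using continuous_map_image_closure_subset[OF continuous_map_complex_values] assms(3) by fastforce
  also have "\<dots> = closure (convex hull (complex_values u z ` C))"
    by (simp add: convex_hull_linear_image[OF linear_complex_values])
  also have "\<dots> \<subseteq> convex hull (closure (complex_values u z ` C))"
    by (intro closure_convex_hull_subset bounded_complex_values[OF assms(1,2)])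
  finally show ?thesis .
qed

lemma closure_complex_values_imp_limit_values:
  fixes C :: "('z::real_normed_vector \<Rightarrow>\<^sub>L 'k::real_or_complex) set"
  assumes le: "\<And>\<phi>. \<phi> \<in> C \<Longrightarrow> norm (blinfun_apply \<phi> u) \<le> 1"
    and p: "p \<in> closure (complex_values u z ` C)" "Re (fst p) = 1"
  shows "snd p \<in> to_complex ` limit_values C u z"
proof -
  obtain q where q: "\<And>n. q n \<in> complex_values u z ` C" "q \<longlonglongrightarrow> p"
    using p(1) unfolding closure_sequential by blast
  from q(1) obtain \<phi> where \<phi>: "\<And>n. \<phi> n \<in> C" "\<And>n. q n = complex_values u z (\<phi> n)"
    unfolding image_iff by metis
  from \<phi>(2) have "q = (\<lambda>n. complex_values u z (\<phi> n))"
    by (rule ext)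
  with q(2) have lim: "(\<lambda>n. complex_values u z (\<phi> n)) \<longlonglongrightarrow> p"
    by simp
  have "(\<lambda>n. re_part (blinfun_apply (\<phi> n) u)) \<longlonglongrightarrow> 1"
    using tendsto_Re[OF tendsto_fst[OF lim]] p(2) by (simp add: complex_values_def re_part_def)
  then have u: "(\<lambda>n. blinfun_apply (\<phi> n) u) \<longlonglongrightarrow> 1"
    by (simp add: tendsto_1_iff_re_part le \<phi>(1))
  have z: "(\<lambda>n. to_complex (blinfun_apply (\<phi> n) z)) \<longlonglongrightarrow> snd p"
    using tendsto_snd[OF lim] by (simp add: complex_values_def)
  \<comment> \<open>If \<open>'k\<close> is real, a limit in the plane must still be shown to be a
    scalar before it can be read as a limit in \<open>'k\<close>.\<close>
  then have "snd p \<in> range (to_complex :: 'k \<Rightarrow> complex)"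
    by (rule closed_sequentially[OF closed_range_to_complex, rotated]) simp
  then obtain l :: 'k where l: "snd p = to_complex l"
    by blast
  with z have "(\<lambda>n. blinfun_apply (\<phi> n) z) \<longlonglongrightarrow> l"
    by (simp add: tendsto_to_complex_iff)
  with u \<phi>(1) have "l \<in> limit_values C u z"
    unfolding limit_values_def by blast
  with l show ?thesis by simp
qed

section \<open>The supporting face\<close>

lemma numerical_range_subset_convex_hull_limit_values:
  fixes smul :: "'k::real_or_complex \<Rightarrow> 'z::real_normed_vector \<Rightarrow> 'z"
  assumes smul: "normed_space_over smul" and u: "norm u = 1" and C: "C \<subseteq> dual_ball smul"
    and dense: "dual_ball smul \<subseteq> weak_star_topology smul closure_of (convex hull C)"
  shows "numerical_range smul u z \<subseteq> convex hull (limit_values C u z)"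
proof
  fix v assume "v \<in> numerical_range smul u z"
  then obtain \<phi> where \<phi>: "\<phi> \<in> dual_ball smul" "blinfun_apply \<phi> u = 1" "blinfun_apply \<phi> z = v"
    unfolding numerical_range_eq_dual_ball[OF u] by blast
  have le: "norm (blinfun_apply \<psi> u) \<le> 1" if "\<psi> \<in> C" for \<psi>
    using norm_apply_dual_ball_le[OF smul, of \<psi> u] that C u by auto
  define K where "K = closure (complex_values u z ` C)"
  \<comment> \<open>The real inner product with this vector is the real part of the first
    coordinate, so the supporting hyperplane prescribes only that real part.\<close>
  let ?a = "(1, 0) :: complex \<times> complex"
  have K: "compact K"
    unfolding K_def using bounded_complex_values[OF smul C] by simp
  have a: "?a \<bullet> p = Re (fst p)" for p
    by (simp add: inner_prod_def inner_complex_def)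
  have "?a \<bullet> p \<le> 1" if "p \<in> complex_values u z ` C" for p
    using that le order.trans[OF complex_Re_le_cmod]
    by (force simp: a complex_values_def norm_to_complex)
  then have "K \<subseteq> {p. ?a \<bullet> p \<le> 1}"
    unfolding K_def by (intro closure_minimal closed_halfspace_le) auto
  then have "convex hull K \<subseteq> {p. ?a \<bullet> p \<le> 1}"
    by (intro hull_minimal convex_halfspace_le)
  then have "(convex hull K \<inter> {p. ?a \<bullet> p = 1}) face_of (convex hull K)"
    by (intro face_of_Int_supporting_hyperplane_le convex_convex_hull) auto
  \<comment> \<open>A face of the convex hull of a compact set is the hull of some of the generating
    points, so no point of \<open>K\<close> off the hyperplane is needed to represent a point of the
    slice.\<close>
  then obtain S where S: "S \<subseteq> K" "convex hull K \<inter> {p. ?a \<bullet> p = 1} = convex hull S"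
    using face_of_convex_hull_subset[OF K] by metis
  have "complex_values u z \<phi> \<in> convex hull K"
    unfolding K_def using \<phi>(1) dense by (intro complex_values_weak_star_closure[OF smul C]) auto
  then have "(1, to_complex v) \<in> convex hull K"
    by (simp add: complex_values_def \<phi>(2,3) to_complex_one)
  then have "(1, to_complex v) \<in> convex hull K \<inter> {p. ?a \<bullet> p = 1}"
    using a[of "(1, to_complex v)"] by simp
  then have "(1, to_complex v) \<in> convex hull S"
    unfolding S(2) .
  then have "to_complex v \<in> snd ` (convex hull S)"
    by force
  also have "\<dots> = convex hull (snd ` S)"
    by (intro convex_hull_linear_image linear_snd)
  also have "\<dots> \<subseteq> convex hull (to_complex ` limit_values C u z)"
  proof (intro hull_mono image_subsetI)
    fix p assume "p \<in> S"
    \<comment> \<open>Points of \<open>S\<close> lie in its hull, which is the slice, hence on the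
      hyperplane.\<close>
    then have "p \<in> K" "Re (fst p) = 1"
      using S(1) hull_inc[of p S convex] unfolding S(2)[symmetric] by (auto simp: a)
    then show "snd p \<in> to_complex ` limit_values C u z"
      unfolding K_def by (intro closure_complex_values_imp_limit_values le)
  qed
  also have "\<dots> = to_complex ` (convex hull (limit_values C u z))"
    by (simp add: convex_hull_linear_image[OF bounded_linear.linear[OF bounded_linear_to_complex]])
  finally obtain w where "w \<in> convex hull (limit_values C u z)" "to_complex v = to_complex w"
    by blast
  \<comment> \<open>The isometry \<open>to_complex\<close> is injective, so \<open>v\<close> and
    \<open>w\<close> coincide.\<close>
  then show "v \<in> convex hull (limit_values C u z)"
    using dist_to_complex[of v w] by simp
qed

theorem theorem2p3:
  fixes smul :: "'k::real_or_complex \<Rightarrow> 'z::banach \<Rightarrow> 'z"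
    and u :: 'z
    and C :: "('z \<Rightarrow>\<^sub>L 'k) set"
  assumes "normed_space_over smul"
    and "norm u = 1"
    and "C \<subseteq> dual_ball smul"
    and "dual_ball smul = weak_star_topology smul closure_of (convex hull C)"
  shows "\<forall>z. numerical_range smul u z =
        convex hull (\<Inter>\<delta>\<in>{0::real<..}. closure {blinfun_apply \<phi> z | \<phi>. \<phi> \<in> C \<and> re_part (blinfun_apply \<phi> u) > 1 - \<delta>})
      \<and> convex hull (\<Inter>\<delta>\<in>{0::real<..}. closure {blinfun_apply \<phi> z | \<phi>. \<phi> \<in> C \<and> re_part (blinfun_apply \<phi> u) > 1 - \<delta>}) =
        convex hull {l. \<exists>\<phi> :: nat \<Rightarrow> 'z \<Rightarrow>\<^sub>L 'k. (\<forall>n. \<phi> n \<in> C)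
            \<and> (\<lambda>n. blinfun_apply (\<phi> n) u) \<longlonglongrightarrow> 1
            \<and> (\<lambda>n. blinfun_apply (\<phi> n) z) \<longlonglongrightarrow> l}"
proof (intro allI conjI)
  fix z
  have le: "norm (blinfun_apply \<phi> u) \<le> 1" if "\<phi> \<in> C" for \<phi>
    using norm_apply_dual_ball_le[OF assms(1), of \<phi> u] that assms(2,3) by auto
  have slices: "(\<Inter>\<delta>\<in>{0::real<..}. closure {blinfun_apply \<phi> z | \<phi>. \<phi> \<in> C \<and> re_part (blinfun_apply \<phi> u) > 1 - \<delta>})
      = limit_values C u z"
    by (intro Inter_closure_slices_eq_limit_values le)
  show "convex hull (\<Inter>\<delta>\<in>{0::real<..}. closure {blinfun_apply \<phi> z | \<phi>. \<phi> \<in> C \<and> re_part (blinfun_apply \<phi> u) > 1 - \<delta>}) =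
      convex hull {l. \<exists>\<phi> :: nat \<Rightarrow> 'z \<Rightarrow>\<^sub>L 'k. (\<forall>n. \<phi> n \<in> C)
            \<and> (\<lambda>n. blinfun_apply (\<phi> n) u) \<longlonglongrightarrow> 1
            \<and> (\<lambda>n. blinfun_apply (\<phi> n) z) \<longlonglongrightarrow> l}"
    by (simp only: slices limit_values_def)
  show "numerical_range smul u z =
      convex hull (\<Inter>\<delta>\<in>{0::real<..}. closure {blinfun_apply \<phi> z | \<phi>. \<phi> \<in> C \<and> re_part (blinfun_apply \<phi> u) > 1 - \<delta>})"
    \<comment> \<open>One inclusion is the face argument; for the other, the numerical range is
      convex and contains the limits, hence contains their hull.\<close>
    unfolding slices
    using numerical_range_subset_convex_hull_limit_values[OF assms(1-3), of z]
      limit_values_subset_numerical_range[OF assms(1-3), of z]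
      convex_numerical_range[OF assms(1,2), of z] assms(4)
    by (intro equalityI hull_minimal) auto
qed

end
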